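(* Let $G$ be a finite group. Then $\mathrm{girth}(\mathscr{I}_c(G))\in\{3,\infty\}$.
   Context: For a group $G$, the intersection graph of cyclic subgroups of $G$, denoted $\mathscr{I}_c(G)$, is the simple graph whose vertices are all the proper cyclic subgroups of $G$ (cyclic subgroups different from $G$ and from the trivial subgroup), two distinct vertices being adjacent if and only if their intersection is a non-trivial subgroup. The girth of a graph is the length of its shortest cycle if it has a cycle, and $\infty$ otherwise. *)

theory Defs
  imports
    "HOL-Algebra.Elementary_Groups"
    "HOL-Library.Extended_Nat"
    "Graph_Theory.Pair_Digraph"
begin

definition proper_cyclic_subgroups :: "('a, 'b) monoid_scheme \<Rightarrow> 'a set set" where
  "proper_cyclic_subgroups G =
    {H. subgroup H G \<and> cyclic_group (G\<lparr>carrier := H\<rparr>) \<and>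
        H \<noteq> carrier G \<and> H \<noteq> {\<one>\<^bsub>G\<^esub>}}"

text \<open>
  A simple graph is represented as a symmetric loop-free digraph without parallel arcs: every
  edge contributes both orientations to the set of arcs.
\<close>
definition cyclic_intersection_graph :: "('a, 'b) monoid_scheme \<Rightarrow> 'a set pair_pre_digraph" where
  "cyclic_intersection_graph G =
    \<lparr>pverts = proper_cyclic_subgroups G,
     parcs = {(H, K). H \<in> proper_cyclic_subgroups G \<and> K \<in> proper_cyclic_subgroups G \<and>
                      H \<noteq> K \<and> H \<inter> K \<noteq> {\<one>\<^bsub>G\<^esub>}}\<rparr>"

text \<open>
  In a symmetric digraph \<^const>\<open>pre_digraph.cycle\<close> also admits the walk \<open>u, v, u\<close> along a single
  edge. The cycles of the underlying simple graph are those of length at least 3. The infimum of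
  the empty set in \<^typ>\<open>enat\<close> is \<open>\<infinity>\<close>.
\<close>
definition girth :: "'v pair_pre_digraph \<Rightarrow> enat" where
  "girth \<Gamma> = (INF p \<in> {p. pre_digraph.cycle (with_proj \<Gamma>) p \<and> 3 \<le> length p}. enat (length p))"

lemma girth_eq_infinity_iff:
  "girth \<Gamma> = \<infinity> \<longleftrightarrow> (\<nexists>p. pre_digraph.cycle (with_proj \<Gamma>) p \<and> 3 \<le> length p)"
  unfolding girth_def top_enat_def[symmetric] INF_top_conv by (auto simp: top_enat_def)

lemma pair_graph_cyclic_intersection_graph:
  assumes "group G" "finite (carrier G)"
  shows "pair_graph (cyclic_intersection_graph G)"
proof -
  have "proper_cyclic_subgroups G \<subseteq> Pow (carrier G)"
    by (auto simp: proper_cyclic_subgroups_def dest: subgroup.mem_carrier)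
  then have fin: "finite (proper_cyclic_subgroups G)"
    using assms(2) by (meson finite_Pow_iff finite_subset)
  have "parcs (cyclic_intersection_graph G) \<subseteq>
      proper_cyclic_subgroups G \<times> proper_cyclic_subgroups G"
    by (auto simp: cyclic_intersection_graph_def)
  then have "finite (parcs (cyclic_intersection_graph G))"
    using fin by (meson finite_SigmaI finite_subset)
  then show ?thesis
    using fin
    by unfold_locales
      (auto simp: cyclic_intersection_graph_def symmetric_def sym_def Int_commute)
qed

lemma (in group) mem_proper_cyclic_subgroups_iff:
  "H \<in> proper_cyclic_subgroups G \<longleftrightarrow>
    (\<exists>x \<in> carrier G. H = generate G {x}) \<and> H \<noteq> carrier G \<and> H \<noteq> {\<one>}"
proof -
  have gen: "generate (G\<lparr>carrier := H\<rparr>) {x} = generate G {x}" if "subgroup H G" "x \<in> H" for x H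
    using generate_consistent[of "{x}" H] that by simp
  have "subgroup H G \<and> cyclic_group (G\<lparr>carrier := H\<rparr>) \<longleftrightarrow> (\<exists>x \<in> carrier G. H = generate G {x})"
  proof safe
    assume H: "subgroup H G" and "cyclic_group (G\<lparr>carrier := H\<rparr>)"
    then obtain x where x: "x \<in> H" "subgroup_generated (G\<lparr>carrier := H\<rparr>) {x} = G\<lparr>carrier := H\<rparr>"
      by (auto simp: cyclic_group_def)
    then have "carrier (subgroup_generated (G\<lparr>carrier := H\<rparr>) {x}) = H"
      by simp
    then have "generate G {x} = H"
      using gen[OF H x(1)] x(1) by (simp add: subgroup_generated_def)
    then show "\<exists>x \<in> carrier G. H = generate G {x}"
      using x(1) subgroup.mem_carrier[OF H] by blast
  next
    fix x assume x: "x \<in> carrier G"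
    show sub: "subgroup (generate G {x}) G"
      using x by (simp add: generate_is_subgroup)
    have "x \<in> generate G {x}"
      by (simp add: generate.incl)
    then show "cyclic_group (G\<lparr>carrier := generate G {x}\<rparr>)"
      unfolding cyclic_group_def
      using gen[OF sub] by (intro bexI[of _ x]) (auto simp: subgroup_generated_def)
  qed
  then show ?thesis
    by (auto simp: proper_cyclic_subgroups_def)
qed

end

theory Submission
  imports Defs
begin

text \<open>
  A cycle of length at least 3 contains a path \<open>A, B, C, D\<close> with \<open>A \<noteq> C\<close> and \<open>B \<noteq> D\<close> (where
  \<open>A = D\<close> if the cycle is a triangle), and any such path forces a triangle, because of its middle
  edge. If \<open>B \<subseteq> C\<close>, then \<open>A \<inter> C\<close> contains the non-trivial subgroup \<open>A \<inter> B\<close>, and \<open>A, B, C\<close> is a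
  triangle; if \<open>C \<subseteq> B\<close>, then likewise \<open>B, C, D\<close> is one. If \<open>B\<close> and \<open>C\<close> are incomparable, then the
  cyclic subgroup generated by any non-trivial element of \<open>B \<inter> C\<close> is a third vertex, properly
  contained in both, and forms a triangle with them. The path comes from \<open>cycle_obtains_path\<close>, the
  case distinction is \<open>path_obtains_triangle\<close>, and the third vertex is supplied by
  \<open>adjacent_obtains_common_subgroup\<close>.
\<close>

lemma endpoints_in_pawalk_verts:
  "pcas u p v \<Longrightarrow> {u, v} \<subseteq> set (pawalk_verts u p)"
proof (induction p arbitrary: u)
  case Nil
  then show ?case by simp
next
  case (Cons e p)
  then show ?case by fastforce
qed

lemma cycle_obtains_path:
  assumes "pre_digraph.cycle (with_proj \<Gamma>) p" "3 \<le> length p"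
  obtains a b c d where
    "(a, b) \<in> parcs \<Gamma>" "(b, c) \<in> parcs \<Gamma>" "(c, d) \<in> parcs \<Gamma>" "a \<noteq> c" "b \<noteq> d"
proof -
  obtain u where p: "set p \<subseteq> parcs \<Gamma>" "pcas u p u" "distinct (tl (pawalk_verts u p))"
    using assms(1)
    by (auto simp: pre_digraph.cycle_def pre_digraph.awalk_def cas_with_proj_eq
        awalk_verts_with_proj_eq)
  obtain e\<^sub>1 e\<^sub>2 e\<^sub>3 q where p_eq: "p = e\<^sub>1 # e\<^sub>2 # e\<^sub>3 # q"
    using assms(2) by (auto simp: numeral_3_eq_3 Suc_le_length_iff)
  obtain a b c d where e: "e\<^sub>1 = (a, b)" "e\<^sub>2 = (b, c)" "e\<^sub>3 = (c, d)" "a = u"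
    using p(2) by (cases e\<^sub>1; cases e\<^sub>2; cases e\<^sub>3) (auto simp: p_eq)
  \<comment> \<open>Distinctness is given for the vertex list without its first entry \<open>u\<close>; since the walk is
    closed, \<open>u\<close> recurs as the last entry, which lies after \<open>c\<close>.\<close>
  have "{d, u} \<subseteq> set (pawalk_verts d q)"
    using p(2) endpoints_in_pawalk_verts by (simp add: p_eq e)
  then have "a \<noteq> c" "b \<noteq> d"
    using p(3) by (auto simp: p_eq e)
  then show thesis
    using that p(1) by (auto simp: p_eq e)
qed

lemma girth_eq_3_if_triangle:
  assumes "pair_loopfree_digraph \<Gamma>"
    and "(a, b) \<in> parcs \<Gamma>" "(b, c) \<in> parcs \<Gamma>" "(c, a) \<in> parcs \<Gamma>"
  shows "girth \<Gamma> = 3"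
proof -
  interpret pair_loopfree_digraph \<Gamma> by fact
  let ?p = "[(a, b), (b, c), (c, a)]"
  have "distinct [b, c, a]"
    using assms no_loops' by auto
  then have "pre_digraph.cycle (with_proj \<Gamma>) ?p"
    using assms in_arcsD1
    by (auto simp: pre_digraph.cycle_def pre_digraph.awalk_def cas_with_proj_eq
        awalk_verts_with_proj_eq)
  then have "girth \<Gamma> \<le> enat (length ?p)"
    unfolding girth_def by (intro INF_lower) simp
  moreover have "enat 3 \<le> girth \<Gamma>"
    unfolding girth_def by (intro INF_greatest) simp
  ultimately show ?thesis
    by (simp add: numeral_eq_enat numeral_3_eq_3)
qed

context group
begin

lemma one_mem_proper_cyclic_subgroup:
  "H \<in> proper_cyclic_subgroups G \<Longrightarrow> \<one> \<in> H"
  by (simp add: proper_cyclic_subgroups_def subgroup.one_closed)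

lemma adjacent_if_subset:
  assumes "H \<in> proper_cyclic_subgroups G" "K \<in> proper_cyclic_subgroups G" "H \<subset> K"
  shows "(H, K) \<in> parcs (cyclic_intersection_graph G)"
proof -
  have "H \<inter> K = H" "H \<noteq> {\<one>}"
    using assms by (auto simp: proper_cyclic_subgroups_def)
  then show ?thesis
    using assms by (auto simp: cyclic_intersection_graph_def)
qed

lemma adjacent_sym:
  "(H, K) \<in> parcs (cyclic_intersection_graph G) \<Longrightarrow>
    (K, H) \<in> parcs (cyclic_intersection_graph G)"
  by (auto simp: cyclic_intersection_graph_def Int_commute)

lemma adjacent_if_adjacent_subset:
  assumes "(H, K) \<in> parcs (cyclic_intersection_graph G)"
    and "L \<in> proper_cyclic_subgroups G" "K \<subseteq> L" "H \<noteq> L"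
  shows "(H, L) \<in> parcs (cyclic_intersection_graph G)"
proof -
  have "H \<inter> K \<noteq> {\<one>}" "\<one> \<in> H \<inter> K"
    using assms(1) one_mem_proper_cyclic_subgroup by (auto simp: cyclic_intersection_graph_def)
  then have "H \<inter> L \<noteq> {\<one>}"
    using assms(3) by blast
  then show ?thesis
    using assms by (auto simp: cyclic_intersection_graph_def)
qed

text \<open>
  Taking the subgroup generated by one element of \<open>H \<inter> K\<close>, rather than \<open>H \<inter> K\<close> itself, makes
  cyclicity hold by construction instead of through the subgroup theorem for cyclic groups.
\<close>
lemma adjacent_obtains_common_subgroup:
  assumes "(H, K) \<in> parcs (cyclic_intersection_graph G)"
  obtains L where "L \<in> proper_cyclic_subgroups G" "L \<subseteq> H" "L \<subseteq> K"
proof -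
  have H: "H \<in> proper_cyclic_subgroups G" and K: "K \<in> proper_cyclic_subgroups G"
    and "H \<inter> K \<noteq> {\<one>}"
    using assms by (auto simp: cyclic_intersection_graph_def)
  moreover have "\<one> \<in> H \<inter> K"
    using H K one_mem_proper_cyclic_subgroup by blast
  ultimately obtain x where x: "x \<in> H" "x \<in> K" "x \<noteq> \<one>"
    by blast
  have sub: "subgroup H G" "subgroup K G" "H \<noteq> carrier G"
    using H K by (auto simp: proper_cyclic_subgroups_def)
  have x_carrier: "x \<in> carrier G"
    using sub(1) x(1) by (rule subgroup.mem_carrier)
  have le: "generate G {x} \<subseteq> H" "generate G {x} \<subseteq> K"
    using x sub(1,2) by (simp_all add: generate_subgroup_incl)
  \<comment> \<open>The generated subgroup is proper because it lies in the proper subgroup \<open>H\<close>.\<close>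
  have "generate G {x} \<noteq> carrier G"
    using le(1) sub subgroup.subset by blast
  moreover have "generate G {x} \<noteq> {\<one>}"
    using x(3) generate.incl[of x "{x}" G] by auto
  ultimately have "generate G {x} \<in> proper_cyclic_subgroups G"
    using x_carrier by (auto simp: mem_proper_cyclic_subgroups_iff)
  then show thesis
    using le that by blast
qed

lemma path_obtains_triangle:
  assumes "(A, B) \<in> parcs (cyclic_intersection_graph G)"
    and "(B, C) \<in> parcs (cyclic_intersection_graph G)"
    and "(C, D) \<in> parcs (cyclic_intersection_graph G)"
    and "A \<noteq> C" "B \<noteq> D"
  obtains H K L where "(H, K) \<in> parcs (cyclic_intersection_graph G)"
    "(K, L) \<in> parcs (cyclic_intersection_graph G)"
    "(L, H) \<in> parcs (cyclic_intersection_graph G)"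
proof -
  have BC: "B \<in> proper_cyclic_subgroups G" "C \<in> proper_cyclic_subgroups G"
    using assms(2) by (auto simp: cyclic_intersection_graph_def)
  consider "B \<subseteq> C" | "C \<subseteq> B" | "\<not> B \<subseteq> C" "\<not> C \<subseteq> B"
    by blast
  then show thesis
  proof cases
    case 1
    then have "(A, C) \<in> parcs (cyclic_intersection_graph G)"
      using adjacent_if_adjacent_subset assms(1,4) BC(2) by blast
    then show thesis
      using that assms(1,2) adjacent_sym by blast
  next
    case 2
    then have "(D, B) \<in> parcs (cyclic_intersection_graph G)"
      using adjacent_if_adjacent_subset adjacent_sym assms(3,5) BC(1) by metis
    then show thesis
      using that assms(2,3) by blast
  next
    case 3
    obtain L where L: "L \<in> proper_cyclic_subgroups G" "L \<subseteq> B" "L \<subseteq> C"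
      using adjacent_obtains_common_subgroup[OF assms(2)] .
    then have "L \<subset> B" "L \<subset> C"
      using 3 by auto
    then have "(L, B) \<in> parcs (cyclic_intersection_graph G)"
      "(L, C) \<in> parcs (cyclic_intersection_graph G)"
      using L(1) BC adjacent_if_subset by blast+
    then show thesis
      using that assms(2) adjacent_sym by blast
  qed
qed

end

theorem corollary2p3:
  fixes G :: "('a, 'b) monoid_scheme"
  assumes "group G" and "finite (carrier G)"
  shows "girth (cyclic_intersection_graph G) \<in> {3, \<infinity>}"
proof (cases "girth (cyclic_intersection_graph G) = \<infinity>")
  case True
  then show ?thesis by simp
next
  case False
  interpret group G by fact
  have "pair_loopfree_digraph (cyclic_intersection_graph G)"
    using pair_graph_cyclic_intersection_graph[OF assms]
    by (simp add: pair_graph_def pair_digraph_def)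
  obtain p where "pre_digraph.cycle (with_proj (cyclic_intersection_graph G)) p" "3 \<le> length p"
    using False by (auto simp: girth_eq_infinity_iff)
  then obtain A B C D where
    "(A, B) \<in> parcs (cyclic_intersection_graph G)" "(B, C) \<in> parcs (cyclic_intersection_graph G)"
    "(C, D) \<in> parcs (cyclic_intersection_graph G)" "A \<noteq> C" "B \<noteq> D"
    by (rule cycle_obtains_path)
  then obtain H K L where "(H, K) \<in> parcs (cyclic_intersection_graph G)"
    "(K, L) \<in> parcs (cyclic_intersection_graph G)" "(L, H) \<in> parcs (cyclic_intersection_graph G)"
    by (rule path_obtains_triangle)
  with \<open>pair_loopfree_digraph _\<close> have "girth (cyclic_intersection_graph G) = 3"
    by (rule girth_eq_3_if_triangle)
  then show ?thesis by simp
qed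

end
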